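(* (Soundness of $\mathbf{GBU}(G)$.) For every formula $G$: if the sequent $\emptyset\Rightarrow_g G$ is derivable in $\mathbf{GBU}(G)$, then $G$ is valid in intuitionistic propositional logic.
   Context: Formulas are built from a countably infinite set of propositional variables and $\bot$ using $\land,\lor,\supset$. For a formula $G$, $\mathrm{Sl}(G)$ and $\mathrm{Sr}(G)$ are the smallest subsets of the subformulas of $G$ with: $G\in\mathrm{Sr}(G)$; $A\land B$ or $A\lor B$ in $\mathrm{Sl}(G)$ (resp. $\mathrm{Sr}(G)$) implies $A,B$ in $\mathrm{Sl}(G)$ (resp. $\mathrm{Sr}(G)$); $A\supset B\in\mathrm{Sl}(G)$ implies $B\in\mathrm{Sl}(G)$, $A\in\mathrm{Sr}(G)$; $A\supset B\in\mathrm{Sr}(G)$ implies $B\in\mathrm{Sr}(G)$, $A\in\mathrm{Sl}(G)$. $\mathrm{Cl}(\Gamma)$ is the smallest set containing $\Gamma$ such that if $X,Y\in\mathrm{Cl}(\Gamma)$ and $A$ is any formula then $X\land Y,A\lor X,X\lor A,A\supset X\in\mathrm{Cl}(\Gamma)$. Commas denote union. $\mathbf{GBU}(G)$: sequents regular $\Psi\Rightarrow_g A$ and irregular $\Psi\rightarrow_g A$ with $\Psi\subseteq\mathrm{Sl}(G)$, $A\in\mathrm{Sr}(G)$ (all sequents in rules satisfy this). Rules ($k\in\{1,2\}$): axioms $A,\Psi\Rightarrow_g A$, $\bot,\Psi\Rightarrow_g C$, $A,\Psi\rightarrow_g A$; $L\land$: $A,B,\Psi\Rightarrow_g C/A\land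 B,\Psi\Rightarrow_g C$; $R\land$: $\Psi\Rightarrow_g A$, $\Psi\Rightarrow_g B/\Psi\Rightarrow_g A\land B$ and likewise with $\rightarrow_g$ throughout; $L\lor$: $A,\Psi\Rightarrow_g C$, $B,\Psi\Rightarrow_g C/A\lor B,\Psi\Rightarrow_g C$; $R\lor_k$: $\Psi\rightarrow_g C_k/\Psi\Rightarrow_g C_1\lor C_2$ and $\Psi\rightarrow_g C_k/\Psi\rightarrow_g C_1\lor C_2$; $L\supset$: $A\supset B,\Psi\rightarrow_g A$, $B,\Psi\Rightarrow_g C/A\supset B,\Psi\Rightarrow_g C$; $\supset R_\in$: $\Psi\Rightarrow_g B/\Psi\Rightarrow_g A\supset B$ and $\Psi\rightarrow_g B/\Psi\rightarrow_g A\supset B$, if $A\in\mathrm{Cl}(\Psi)$; $\supset R_{\notin}$: $A,\Psi\Rightarrow_g B/\Psi\Rightarrow_g A\supset B$ and $A,\Psi\Rightarrow_g B/\Psi\rightarrow_g A\supset B$, if $A\notin\mathrm{Cl}(\Psi)$. *)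

theory Defs
  imports Main
begin

datatype form =
    Var nat
  | Bot
  | And form form
  | Or form form
  | Imp form form

fun subforms :: "form \<Rightarrow> form set" where
  "subforms (Var p) = {Var p}"
| "subforms Bot = {Bot}"
| "subforms (And A B) = insert (And A B) (subforms A \<union> subforms B)"
| "subforms (Or A B) = insert (Or A B) (subforms A \<union> subforms B)"
| "subforms (Imp A B) = insert (Imp A B) (subforms A \<union> subforms B)"

inductive_set Sl :: "form \<Rightarrow> form set" and Sr :: "form \<Rightarrow> form set" for G :: form where
  Sr_refl: "G \<in> Sr G"
| Sl_And1: "And A B \<in> Sl G \<Longrightarrow> A \<in> Sl G"
| Sl_And2: "And A B \<in> Sl G \<Longrightarrow> B \<in> Sl G"
| Sl_Or1: "Or A B \<in> Sl G \<Longrightarrow> A \<in> Sl G"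
| Sl_Or2: "Or A B \<in> Sl G \<Longrightarrow> B \<in> Sl G"
| Sr_And1: "And A B \<in> Sr G \<Longrightarrow> A \<in> Sr G"
| Sr_And2: "And A B \<in> Sr G \<Longrightarrow> B \<in> Sr G"
| Sr_Or1: "Or A B \<in> Sr G \<Longrightarrow> A \<in> Sr G"
| Sr_Or2: "Or A B \<in> Sr G \<Longrightarrow> B \<in> Sr G"
| Sl_Imp_right: "Imp A B \<in> Sl G \<Longrightarrow> B \<in> Sl G"
| Sl_Imp_left: "Imp A B \<in> Sl G \<Longrightarrow> A \<in> Sr G"
| Sr_Imp_right: "Imp A B \<in> Sr G \<Longrightarrow> B \<in> Sr G"
| Sr_Imp_left: "Imp A B \<in> Sr G \<Longrightarrow> A \<in> Sl G"

text \<open>The inductive definition does not mention subformulas, but its least solution consists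
  of subformulas of \<open>G\<close>. In particular \<open>Sl G\<close> and \<open>Sr G\<close> are finite.\<close>

lemma subforms_refl: "A \<in> subforms A"
  by (cases A) auto

lemma subforms_trans: "A \<in> subforms B \<Longrightarrow> B \<in> subforms C \<Longrightarrow> A \<in> subforms C"
  by (induction C) auto

lemma Sl_Sr_mem_subforms:
  "A \<in> Sl G \<Longrightarrow> A \<in> subforms G"
  "A \<in> Sr G \<Longrightarrow> A \<in> subforms G"
  by (induction rule: Sl_Sr.inducts)
     (auto intro: subforms_refl elim!: subforms_trans[rotated])

lemma finite_subforms: "finite (subforms A)"
  by (induction A) auto

lemma finite_Sl: "finite (Sl G)" and finite_Sr: "finite (Sr G)"
  using Sl_Sr_mem_subforms by (blast intro: finite_subset[OF _ finite_subforms])+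

inductive_set Cl :: "form set \<Rightarrow> form set" for \<Gamma> :: "form set" where
  Cl_base: "X \<in> \<Gamma> \<Longrightarrow> X \<in> Cl \<Gamma>"
| Cl_And: "X \<in> Cl \<Gamma> \<Longrightarrow> Y \<in> Cl \<Gamma> \<Longrightarrow> And X Y \<in> Cl \<Gamma>"
| Cl_Or1: "X \<in> Cl \<Gamma> \<Longrightarrow> Or A X \<in> Cl \<Gamma>"
| Cl_Or2: "X \<in> Cl \<Gamma> \<Longrightarrow> Or X A \<in> Cl \<Gamma>"
| Cl_Imp: "X \<in> Cl \<Gamma> \<Longrightarrow> Imp A X \<in> Cl \<Gamma>"

datatype sequent =
    Regular "form set" form  (infix "\<Rightarrow>g" 50)
  | Irregular "form set" form  (infix "\<rightarrow>g" 50)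

fun sequent_of :: "form \<Rightarrow> sequent \<Rightarrow> bool" where
  "sequent_of G (\<Psi> \<Rightarrow>g A) \<longleftrightarrow> \<Psi> \<subseteq> Sl G \<and> A \<in> Sr G"
| "sequent_of G (\<Psi> \<rightarrow>g A) \<longleftrightarrow> \<Psi> \<subseteq> Sl G \<and> A \<in> Sr G"

text \<open>Left-hand sides are sets, so \<open>insert\<close> renders the comma; the principal formula may also
  belong to \<open>\<Psi>\<close>. The side condition \<open>sequent_of G\<close> is imposed on the conclusion of each
  rule; derivable premises satisfy it as well (lemma \<open>GBU_sequent_of\<close> below).\<close>

inductive GBU :: "form \<Rightarrow> sequent \<Rightarrow> bool" for G :: form where
  Ax_reg: "sequent_of G (insert A \<Psi> \<Rightarrow>g A) \<Longrightarrow> GBU G (insert A \<Psi> \<Rightarrow>g A)"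
| Ax_bot: "sequent_of G (insert Bot \<Psi> \<Rightarrow>g C) \<Longrightarrow> GBU G (insert Bot \<Psi> \<Rightarrow>g C)"
| Ax_irr: "sequent_of G (insert A \<Psi> \<rightarrow>g A) \<Longrightarrow> GBU G (insert A \<Psi> \<rightarrow>g A)"
| L_And: "GBU G (insert A (insert B \<Psi>) \<Rightarrow>g C)
    \<Longrightarrow> sequent_of G (insert (And A B) \<Psi> \<Rightarrow>g C)
    \<Longrightarrow> GBU G (insert (And A B) \<Psi> \<Rightarrow>g C)"
| R_And_reg: "GBU G (\<Psi> \<Rightarrow>g A) \<Longrightarrow> GBU G (\<Psi> \<Rightarrow>g B)
    \<Longrightarrow> sequent_of G (\<Psi> \<Rightarrow>g And A B)
    \<Longrightarrow> GBU G (\<Psi> \<Rightarrow>g And A B)"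
| R_And_irr: "GBU G (\<Psi> \<rightarrow>g A) \<Longrightarrow> GBU G (\<Psi> \<rightarrow>g B)
    \<Longrightarrow> sequent_of G (\<Psi> \<rightarrow>g And A B)
    \<Longrightarrow> GBU G (\<Psi> \<rightarrow>g And A B)"
| L_Or: "GBU G (insert A \<Psi> \<Rightarrow>g C) \<Longrightarrow> GBU G (insert B \<Psi> \<Rightarrow>g C)
    \<Longrightarrow> sequent_of G (insert (Or A B) \<Psi> \<Rightarrow>g C)
    \<Longrightarrow> GBU G (insert (Or A B) \<Psi> \<Rightarrow>g C)"
| R_Or1_reg: "GBU G (\<Psi> \<rightarrow>g C1)
    \<Longrightarrow> sequent_of G (\<Psi> \<Rightarrow>g Or C1 C2)
    \<Longrightarrow> GBU G (\<Psi> \<Rightarrow>g Or C1 C2)"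
| R_Or2_reg: "GBU G (\<Psi> \<rightarrow>g C2)
    \<Longrightarrow> sequent_of G (\<Psi> \<Rightarrow>g Or C1 C2)
    \<Longrightarrow> GBU G (\<Psi> \<Rightarrow>g Or C1 C2)"
| R_Or1_irr: "GBU G (\<Psi> \<rightarrow>g C1)
    \<Longrightarrow> sequent_of G (\<Psi> \<rightarrow>g Or C1 C2)
    \<Longrightarrow> GBU G (\<Psi> \<rightarrow>g Or C1 C2)"
| R_Or2_irr: "GBU G (\<Psi> \<rightarrow>g C2)
    \<Longrightarrow> sequent_of G (\<Psi> \<rightarrow>g Or C1 C2)
    \<Longrightarrow> GBU G (\<Psi> \<rightarrow>g Or C1 C2)"
| L_Imp: "GBU G (insert (Imp A B) \<Psi> \<rightarrow>g A) \<Longrightarrow> GBU G (insert B \<Psi> \<Rightarrow>g C)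
    \<Longrightarrow> sequent_of G (insert (Imp A B) \<Psi> \<Rightarrow>g C)
    \<Longrightarrow> GBU G (insert (Imp A B) \<Psi> \<Rightarrow>g C)"
| R_Imp_in_reg: "GBU G (\<Psi> \<Rightarrow>g B) \<Longrightarrow> A \<in> Cl \<Psi>
    \<Longrightarrow> sequent_of G (\<Psi> \<Rightarrow>g Imp A B)
    \<Longrightarrow> GBU G (\<Psi> \<Rightarrow>g Imp A B)"
| R_Imp_in_irr: "GBU G (\<Psi> \<rightarrow>g B) \<Longrightarrow> A \<in> Cl \<Psi>
    \<Longrightarrow> sequent_of G (\<Psi> \<rightarrow>g Imp A B)
    \<Longrightarrow> GBU G (\<Psi> \<rightarrow>g Imp A B)"
| R_Imp_notin_reg: "GBU G (insert A \<Psi> \<Rightarrow>g B) \<Longrightarrow> A \<notin> Cl \<Psi>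
    \<Longrightarrow> sequent_of G (\<Psi> \<Rightarrow>g Imp A B)
    \<Longrightarrow> GBU G (\<Psi> \<Rightarrow>g Imp A B)"
| R_Imp_notin_irr: "GBU G (insert A \<Psi> \<Rightarrow>g B) \<Longrightarrow> A \<notin> Cl \<Psi>
    \<Longrightarrow> sequent_of G (\<Psi> \<rightarrow>g Imp A B)
    \<Longrightarrow> GBU G (\<Psi> \<rightarrow>g Imp A B)"

lemma GBU_sequent_of: "GBU G s \<Longrightarrow> sequent_of G s"
  by (auto elim: GBU.cases)

text \<open>Kripke semantics. Models are arbitrary posets of worlds, neither necessarily finite nor
  rooted; \<open>le\<close> relates only elements of \<open>W\<close>, as this is part of \<open>partial_order_on\<close>.\<close>

definition kripke_model :: "'w set \<Rightarrow> 'w rel \<Rightarrow> ('w \<Rightarrow> nat set) \<Rightarrow> bool" where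
  "kripke_model W le V \<longleftrightarrow>
     W \<noteq> {} \<and> partial_order_on W le \<and> (\<forall>(w, v) \<in> le. V w \<subseteq> V v)"

fun forces :: "'w rel \<Rightarrow> ('w \<Rightarrow> nat set) \<Rightarrow> 'w \<Rightarrow> form \<Rightarrow> bool" where
  "forces le V w (Var p) \<longleftrightarrow> p \<in> V w"
| "forces le V w Bot \<longleftrightarrow> False"
| "forces le V w (And A B) \<longleftrightarrow> forces le V w A \<and> forces le V w B"
| "forces le V w (Or A B) \<longleftrightarrow> forces le V w A \<or> forces le V w B"
| "forces le V w (Imp A B) \<longleftrightarrow> (\<forall>v. (w, v) \<in> le \<longrightarrow> forces le V v A \<longrightarrow> forces le V v B)"

text \<open>A definition cannot quantify over types, so the type of worlds is a parameter; validity
  in intuitionistic logic is \<open>ipl_valid TYPE('w)\<close> for every type \<open>'w\<close>.\<close>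

definition ipl_valid :: "'w itself \<Rightarrow> form \<Rightarrow> bool" where
  "ipl_valid (_ :: 'w itself) A \<longleftrightarrow>
     (\<forall>(W :: 'w set) le V. kripke_model W le V \<longrightarrow> (\<forall>w \<in> W. forces le V w A))"

end

theory Submission
  imports Defs
begin

text \<open>Each rule preserves consequence read world by world in a fixed Kripke model. Both arrows
  get the same reading, so rules that pass between them are harmless. Right implication looks at
  later worlds; there persistence (\<open>forces_mono\<close>) keeps the context true. Induction on
  derivations gives \<open>GBU_consequence\<close>; for an empty context this is validity.\<close>

fun consequence :: "'w set \<Rightarrow> 'w rel \<Rightarrow> ('w \<Rightarrow> nat set) \<Rightarrow> sequent \<Rightarrow> bool" where
  "consequence W le V (\<Psi> \<Rightarrow>g A) \<longleftrightarrow>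
     (\<forall>w \<in> W. (\<forall>X \<in> \<Psi>. forces le V w X) \<longrightarrow> forces le V w A)"
| "consequence W le V (\<Psi> \<rightarrow>g A) \<longleftrightarrow>
     (\<forall>w \<in> W. (\<forall>X \<in> \<Psi>. forces le V w X) \<longrightarrow> forces le V w A)"

context
  fixes W :: "'w set" and le V
  assumes model: "kripke_model W le V"
begin

lemma le_refl: "w \<in> W \<Longrightarrow> (w, w) \<in> le"
  using model by (auto simp: kripke_model_def partial_order_on_def preorder_on_def dest: refl_onD)

lemma le_trans: "(u, v) \<in> le \<Longrightarrow> (v, w) \<in> le \<Longrightarrow> (u, w) \<in> le"
  using model by (auto simp: kripke_model_def partial_order_on_def preorder_on_def dest: transD)

lemma le_world: "(w, v) \<in> le \<Longrightarrow> v \<in> W"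
  using model by (auto simp: kripke_model_def partial_order_on_def preorder_on_def refl_on_def)

text \<open>Only variables and implications need the model: valuations grow along \<open>le\<close>,
  and by transitivity worlds above \<open>v\<close> are above \<open>w\<close>.\<close>

lemma forces_mono: "(w, v) \<in> le \<Longrightarrow> forces le V w A \<Longrightarrow> forces le V v A"
proof (induction A)
  case (Var p)
  then show ?case using model by (auto simp: kripke_model_def)
next
  case (Imp A B)
  then show ?case by (auto intro: le_trans)
qed auto

lemma GBU_consequence: "GBU G s \<Longrightarrow> consequence W le V s"
proof (induction rule: GBU.induct)
  \<comment> \<open>The first premise yields \<open>A\<close> at \<open>w\<close>; reflexivity lets
    \<open>Imp A B\<close> be applied at \<open>w\<close> itself, giving \<open>B\<close> for the
    second premise.\<close>
  case (L_Imp A B \<Psi> C)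
  then show ?case using le_refl by simp
next
  \<comment> \<open>At \<open>v\<close> above \<open>w\<close> forcing \<open>A\<close>, persistence
    brings \<open>\<Psi>\<close> along, so the premise applies at \<open>v\<close>.\<close>
  case (R_Imp_notin_reg A \<Psi> B)
  then show ?case using le_world forces_mono by simp
next
  case (R_Imp_notin_irr A \<Psi> B)
  then show ?case using le_world forces_mono by simp
qed (auto intro: le_world forces_mono)

end

theorem theorem5p2:
  fixes G :: form
  assumes "GBU G ({} \<Rightarrow>g G)"
  shows "ipl_valid TYPE('w) G"
  using GBU_consequence[OF _ assms] by (auto simp: ipl_valid_def)

end
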